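(* Suppose that $R$ is a commutative ring, $S$ is an $R$-module, and $e\in S$ is an element such that the evaluation map $\mathrm{Hom}_R(S,S)\to S$, $f\mapsto f(e)$, is an isomorphism. Then $S$ admits a unique ($R$-bilinear) binary multiplication such that $e^2=e$, and under this multiplication $S$ becomes a commutative $R$-algebra with unit $e$.
   Context: Algebras are associative and unital; a binary multiplication on $S$ means an $R$-module map $S\otimes_R S\to S$. *)

theory Defs
  imports "HOL-Algebra.Module"
begin

definition linear_maps ::
  "('a, 'k) ring_scheme \<Rightarrow> ('a, 'b, 'm) module_scheme \<Rightarrow> ('a, 'c, 'n) module_scheme \<Rightarrow> ('b \<Rightarrow> 'c) set"
  where "linear_maps R M N =
    {f \<in> hom (add_monoid M) (add_monoid N).
      \<forall>a \<in> carrier R. \<forall>x \<in> carrier M. f (a \<odot>\<^bsub>M\<^esub> x) = a \<odot>\<^bsub>N\<^esub> f x}"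

definition linear_isos ::
  "('a, 'k) ring_scheme \<Rightarrow> ('a, 'b, 'm) module_scheme \<Rightarrow> ('a, 'c, 'n) module_scheme \<Rightarrow> ('b \<Rightarrow> 'c) set"
  where "linear_isos R M N = {f \<in> linear_maps R M N. bij_betw f (carrier M) (carrier N)}"

text \<open>Linear maps are only determined by their values on \<open>carrier M\<close>, so the elements of
  the Hom module are required to be extensional. The record type of modules extends that of
  rings; the fields \<open>mult\<close> and \<open>one\<close> play no role in \<^locale>\<open>module\<close>.\<close>

definition Hom_module ::
  "('a, 'k) ring_scheme \<Rightarrow> ('a, 'b, 'm) module_scheme \<Rightarrow> ('a, 'c, 'n) module_scheme \<Rightarrow>
    ('a, 'b \<Rightarrow> 'c) module"
  where "Hom_module R M N =
    \<lparr>carrier = linear_maps R M N \<inter> extensional (carrier M),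
     mult = undefined,
     one = undefined,
     zero = (\<lambda>x \<in> carrier M. \<zero>\<^bsub>N\<^esub>),
     add = (\<lambda>f g. \<lambda>x \<in> carrier M. f x \<oplus>\<^bsub>N\<^esub> g x),
     smult = (\<lambda>a f. \<lambda>x \<in> carrier M. a \<odot>\<^bsub>N\<^esub> f x)\<rparr>"

text \<open>A module map out of the tensor product of \<open>M\<close> and \<open>N\<close> is given as a bilinear map on
  pairs. Extensionality makes equality of such maps mean agreement on the carriers.\<close>

definition bilinear_maps ::
  "('a, 'k) ring_scheme \<Rightarrow> ('a, 'b, 'l) module_scheme \<Rightarrow> ('a, 'c, 'm) module_scheme \<Rightarrow>
    ('a, 'd, 'n) module_scheme \<Rightarrow> ('b \<times> 'c \<Rightarrow> 'd) set"
  where "bilinear_maps R M N P =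
    {f \<in> extensional (carrier M \<times> carrier N).
      (\<forall>x \<in> carrier M. (\<lambda>y. f (x, y)) \<in> linear_maps R N P) \<and>
      (\<forall>y \<in> carrier N. (\<lambda>x. f (x, y)) \<in> linear_maps R M P)}"

abbreviation binary_multiplications ::
  "('a, 'k) ring_scheme \<Rightarrow> ('a, 'b, 'm) module_scheme \<Rightarrow> ('b \<times> 'b \<Rightarrow> 'b) set"
  where "binary_multiplications R S \<equiv> bilinear_maps R S S S"

lemma module_Hom_module:
  assumes "module R M" "module R N"
  shows "module R (Hom_module R M N)"
proof -
  interpret M: module R M by fact
  interpret N: module R N by fact
  have clos: "f x \<in> carrier N" if "f \<in> carrier (Hom_module R M N)" "x \<in> carrier M" for f x
    using that by (auto simp: Hom_module_def linear_maps_def hom_def)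
  have ext: "f = g" if "f \<in> carrier (Hom_module R M N)" "g \<in> carrier (Hom_module R M N)"
    "\<And>x. x \<in> carrier M \<Longrightarrow> f x = g x" for f g
    using that by (auto simp: Hom_module_def intro: extensionalityI)
  have add: "f \<oplus>\<^bsub>Hom_module R M N\<^esub> g \<in> carrier (Hom_module R M N)"
    if "f \<in> carrier (Hom_module R M N)" "g \<in> carrier (Hom_module R M N)" for f g
    using that by (auto simp: Hom_module_def linear_maps_def hom_def Pi_def N.smult_r_distr
        N.M.add.m_ac)
  have zero: "\<zero>\<^bsub>Hom_module R M N\<^esub> \<in> carrier (Hom_module R M N)"
    by (auto simp: Hom_module_def linear_maps_def hom_def)
  have smult: "a \<odot>\<^bsub>Hom_module R M N\<^esub> f \<in> carrier (Hom_module R M N)"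
    if "a \<in> carrier R" "f \<in> carrier (Hom_module R M N)" for a f
    using that by (auto simp: Hom_module_def linear_maps_def hom_def Pi_def N.smult_r_distr
        N.smult_assoc1[symmetric] M.R.m_comm)
  have addx: "(f \<oplus>\<^bsub>Hom_module R M N\<^esub> g) x = f x \<oplus>\<^bsub>N\<^esub> g x" if "x \<in> carrier M" for f g x
    using that by (simp add: Hom_module_def)
  have zerox: "\<zero>\<^bsub>Hom_module R M N\<^esub> x = \<zero>\<^bsub>N\<^esub>" if "x \<in> carrier M" for x
    using that by (simp add: Hom_module_def)
  have smultx: "(a \<odot>\<^bsub>Hom_module R M N\<^esub> f) x = a \<odot>\<^bsub>N\<^esub> f x" if "x \<in> carrier M" for a f x
    using that by (simp add: Hom_module_def)
  note cl = clos add zero smult and ev = addx zerox smultx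
  show ?thesis
  proof (rule moduleI)
    show "abelian_group (Hom_module R M N)"
    proof (rule abelian_groupI)
      fix f assume f: "f \<in> carrier (Hom_module R M N)"
      show "\<exists>g \<in> carrier (Hom_module R M N).
        g \<oplus>\<^bsub>Hom_module R M N\<^esub> f = \<zero>\<^bsub>Hom_module R M N\<^esub>"
      proof (rule bexI[where x = "(\<ominus>\<^bsub>R\<^esub> \<one>\<^bsub>R\<^esub>) \<odot>\<^bsub>Hom_module R M N\<^esub> f"])
        show "(\<ominus>\<^bsub>R\<^esub> \<one>\<^bsub>R\<^esub>) \<odot>\<^bsub>Hom_module R M N\<^esub> f
            \<oplus>\<^bsub>Hom_module R M N\<^esub> f = \<zero>\<^bsub>Hom_module R M N\<^esub>"
          using f by (intro ext) (auto simp: cl ev N.smult_l_minus N.M.l_neg)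
      qed (simp add: cl f)
    qed (auto intro!: ext simp: cl ev N.M.add.m_ac)
  qed (auto intro!: ext simp: M.R.cring_axioms M.cring_axioms cl ev
      N.smult_l_distr N.smult_r_distr N.smult_assoc1)
qed

end

theory Submission
  imports Defs
begin

text \<open>Since evaluation at \<open>e\<close> is bijective, an endomorphism of \<open>S\<close> is determined by its value
  at \<open>e\<close>, and every \<open>x\<close> is the value at \<open>e\<close> of an endomorphism \<open>L\<^sub>x\<close>. A multiplication with
  \<open>e\<^sup>2 = e\<close> has \<open>e\<close> as a two-sided unit, because multiplication by \<open>e\<close> on either side agrees
  with the identity at \<open>e\<close>; hence \<open>y \<mapsto> x y\<close> takes the value \<open>x\<close> at \<open>e\<close> and must be \<open>L\<^sub>x\<close>.
  Commutativity and associativity are equalities between endomorphisms that agree at \<open>e\<close>.\<close>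

lemma linear_mapsI:
  assumes "\<And>x. x \<in> carrier M \<Longrightarrow> f x \<in> carrier N"
    and "\<And>x y. x \<in> carrier M \<Longrightarrow> y \<in> carrier M \<Longrightarrow> f (x \<oplus>\<^bsub>M\<^esub> y) = f x \<oplus>\<^bsub>N\<^esub> f y"
    and "\<And>a x. a \<in> carrier R \<Longrightarrow> x \<in> carrier M \<Longrightarrow> f (a \<odot>\<^bsub>M\<^esub> x) = a \<odot>\<^bsub>N\<^esub> f x"
  shows "f \<in> linear_maps R M N"
  using assms by (simp add: linear_maps_def hom_def)

lemma linear_mapsD:
  assumes "f \<in> linear_maps R M N"
  shows linear_maps_closed: "x \<in> carrier M \<Longrightarrow> f x \<in> carrier N"
    and linear_maps_add: "x \<in> carrier M \<Longrightarrow> y \<in> carrier M \<Longrightarrow> f (x \<oplus>\<^bsub>M\<^esub> y) = f x \<oplus>\<^bsub>N\<^esub> f y"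
    and linear_maps_smult: "a \<in> carrier R \<Longrightarrow> x \<in> carrier M \<Longrightarrow> f (a \<odot>\<^bsub>M\<^esub> x) = a \<odot>\<^bsub>N\<^esub> f x"
  using assms by (auto simp: linear_maps_def hom_def)

lemma linear_maps_id: "(\<lambda>x. x) \<in> linear_maps R M M"
  by (rule linear_mapsI) simp_all

lemma linear_maps_comp:
  assumes "f \<in> linear_maps R M N" "g \<in> linear_maps R N P"
  shows "(\<lambda>x. g (f x)) \<in> linear_maps R M P"
  by (rule linear_mapsI) (simp_all add: linear_mapsD[OF assms(1)] linear_mapsD[OF assms(2)])

lemma (in module) linear_maps_sum:
  assumes "f \<in> linear_maps R N M" "g \<in> linear_maps R N M"
  shows "(\<lambda>x. f x \<oplus>\<^bsub>M\<^esub> g x) \<in> linear_maps R N M"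
  by (rule linear_mapsI)
    (simp_all add: linear_mapsD[OF assms(1)] linear_mapsD[OF assms(2)] M.add.m_ac smult_r_distr)

text \<open>Commutativity of \<open>R\<close> lets the scalars \<open>a\<close> and \<open>b\<close>
  change places.\<close>

lemma (in module) linear_maps_scale:
  assumes "a \<in> carrier R" "f \<in> linear_maps R N M"
  shows "(\<lambda>x. a \<odot>\<^bsub>M\<^esub> f x) \<in> linear_maps R N M"
proof (rule linear_mapsI)
  fix b x assume "b \<in> carrier R" "x \<in> carrier N"
  with assms(1) show "a \<odot>\<^bsub>M\<^esub> f (b \<odot>\<^bsub>N\<^esub> x) = b \<odot>\<^bsub>M\<^esub> (a \<odot>\<^bsub>M\<^esub> f x)"
    by (simp add: linear_mapsD[OF assms(2)] smult_assoc1[symmetric] R.m_comm)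
qed (simp_all add: linear_mapsD[OF assms(2)] assms(1) smult_r_distr)

text \<open>Linearity only tests values on the carrier, and the module axioms keep sums and scalar
  multiples inside it. This links plain functions to the extensional elements of
  \<open>Hom_module\<close>.\<close>

lemma linear_maps_restrict_iff:
  assumes "module R M"
  shows "restrict f (carrier M) \<in> linear_maps R M N \<longleftrightarrow> f \<in> linear_maps R M N"
proof -
  interpret module R M by fact
  show ?thesis
    by (auto simp: linear_maps_def hom_def Pi_def)
qed

lemma bilinear_mapsD:
  assumes "f \<in> bilinear_maps R M N P"
  shows bilinear_maps_right: "x \<in> carrier M \<Longrightarrow> (\<lambda>y. f (x, y)) \<in> linear_maps R N P"
    and bilinear_maps_left: "y \<in> carrier N \<Longrightarrow> (\<lambda>x. f (x, y)) \<in> linear_maps R M P"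
    and bilinear_maps_extensional: "f \<in> extensional (carrier M \<times> carrier N)"
  using assms by (auto simp: bilinear_maps_def)

lemma bilinear_maps_closed:
  assumes "f \<in> bilinear_maps R M N P" "x \<in> carrier M" "y \<in> carrier N"
  shows "f (x, y) \<in> carrier P"
  using bilinear_maps_right[OF assms(1,2)] assms(3) by (rule linear_maps_closed)

locale evaluation_iso = module R S for R (structure) and S (structure) +
  fixes e
  assumes e_closed: "e \<in> carrier S"
    and eval_iso: "(\<lambda>f. f e) \<in> linear_isos R (Hom_module R S S) S"
begin

text \<open>Injectivity of evaluation at \<open>e\<close>, carried from extensional representatives
  to arbitrary linear maps.\<close>

lemma linear_maps_eqI:
  assumes "f \<in> linear_maps R S S" "g \<in> linear_maps R S S" "f e = g e" "x \<in> carrier S"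
  shows "f x = g x"
proof -
  have "inj_on (\<lambda>f. f e) (carrier (Hom_module R S S))"
    using eval_iso by (simp add: linear_isos_def bij_betw_def)
  moreover have "restrict h (carrier S) \<in> carrier (Hom_module R S S)"
    if "h \<in> linear_maps R S S" for h
    using that by (simp add: Hom_module_def linear_maps_restrict_iff module_axioms)
  ultimately have "restrict f (carrier S) = restrict g (carrier S)"
    using assms(1-3) e_closed by (simp add: inj_on_def)
  with assms(4) show ?thesis
    by (metis restrict_apply')
qed

lemma ex_linear_map:
  assumes "x \<in> carrier S"
  shows "\<exists>f. f \<in> linear_maps R S S \<and> f e = x"
proof -
  have "x \<in> (\<lambda>f. f e) ` carrier (Hom_module R S S)"
    using eval_iso assms by (simp add: linear_isos_def bij_betw_def)
  then show ?thesis
    by (auto simp: Hom_module_def)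
qed

lemma ex_multiplication: "\<exists>\<mu>. \<mu> \<in> binary_multiplications R S \<and> \<mu> (e, e) = e"
proof -
  obtain L where lin: "\<And>x. x \<in> carrier S \<Longrightarrow> L x \<in> linear_maps R S S"
    and val: "\<And>x. x \<in> carrier S \<Longrightarrow> L x e = x"
    using ex_linear_map by metis
  \<comment> \<open>The maps \<open>L x\<close> are chosen separately for each \<open>x\<close>, so
    linearity in \<open>x\<close> needs proof: for each law, both sides are endomorphisms in
    \<open>y\<close> with the same value at \<open>e\<close>.\<close>
  have left: "(\<lambda>x. L x y) \<in> linear_maps R S S" if y: "y \<in> carrier S" for y
  proof (rule linear_mapsI)
    show "L x y \<in> carrier S" if "x \<in> carrier S" for x
      using lin[OF that] y by (rule linear_maps_closed)
    show "L (x \<oplus>\<^bsub>S\<^esub> x') y = L x y \<oplus>\<^bsub>S\<^esub> L x' y" if "x \<in> carrier S" "x' \<in> carrier S" for x x'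
      by (rule linear_maps_eqI[OF lin linear_maps_sum[OF lin lin]]) (simp_all add: that y val)
    show "L (a \<odot>\<^bsub>S\<^esub> x) y = a \<odot>\<^bsub>S\<^esub> L x y" if "a \<in> carrier R" "x \<in> carrier S" for a x
      by (rule linear_maps_eqI[OF lin linear_maps_scale[OF _ lin]]) (simp_all add: that y val)
  qed
  let ?\<mu> = "restrict (\<lambda>(x, y). L x y) (carrier S \<times> carrier S)"
  have "(\<lambda>y. ?\<mu> (x, y)) = restrict (L x) (carrier S)" if "x \<in> carrier S" for x
    using that by auto
  moreover have "(\<lambda>x. ?\<mu> (x, y)) = restrict (\<lambda>x. L x y) (carrier S)" if "y \<in> carrier S" for y
    using that by auto
  ultimately have "?\<mu> \<in> binary_multiplications R S"
    using lin left by (simp add: bilinear_maps_def linear_maps_restrict_iff module_axioms)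
  moreover have "?\<mu> (e, e) = e"
    using e_closed val by simp
  ultimately show ?thesis
    by blast
qed

context
  fixes \<mu>
  assumes mult: "\<mu> \<in> binary_multiplications R S" and idem: "\<mu> (e, e) = e"
begin

lemma mult_e_left: "x \<in> carrier S \<Longrightarrow> \<mu> (e, x) = x"
  using bilinear_maps_right[OF mult e_closed] linear_maps_id idem by (rule linear_maps_eqI)

lemma mult_e_right: "x \<in> carrier S \<Longrightarrow> \<mu> (x, e) = x"
  using bilinear_maps_left[OF mult e_closed] linear_maps_id idem by (rule linear_maps_eqI)

text \<open>Both maps send \<open>e\<close> to \<open>x\<close>, the left one because
  \<open>e\<close> is a right unit. Commutativity, associativity and uniqueness each follow from a
  suitable \<open>f\<close>.\<close>

lemma mult_eq_linear_map:
  assumes "f \<in> linear_maps R S S" "x \<in> carrier S" "f e = x" "y \<in> carrier S"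
  shows "\<mu> (x, y) = f y"
  by (rule linear_maps_eqI[OF bilinear_maps_right[OF mult assms(2)] assms(1)])
    (simp_all add: mult_e_right assms)

text \<open>Here \<open>f\<close> is right multiplication by \<open>x\<close>, which sends
  \<open>e\<close> to \<open>x\<close>.\<close>

lemma mult_commute: "x \<in> carrier S \<Longrightarrow> y \<in> carrier S \<Longrightarrow> \<mu> (x, y) = \<mu> (y, x)"
  by (rule mult_eq_linear_map[OF bilinear_maps_left[OF mult]]) (simp_all add: mult_e_left)

text \<open>Here \<open>f\<close> is left multiplication by \<open>y\<close> followed by left
  multiplication by \<open>x\<close>; it sends \<open>e\<close> to
  \<open>\<mu> (x, y)\<close>.\<close>

lemma mult_assoc:
  assumes "x \<in> carrier S" "y \<in> carrier S" "z \<in> carrier S"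
  shows "\<mu> (\<mu> (x, y), z) = \<mu> (x, \<mu> (y, z))"
  by (rule mult_eq_linear_map[OF linear_maps_comp[OF bilinear_maps_right[OF mult assms(2)]
          bilinear_maps_right[OF mult assms(1)]]])
    (simp_all add: assms mult_e_right bilinear_maps_closed[OF mult])

lemma algebra_mult: "algebra R (S\<lparr>mult := curry \<mu>, one := e\<rparr>)"
proof -
  let ?A = "S\<lparr>mult := curry \<mu>, one := e\<rparr>"
  \<comment> \<open>Linearity in the left factor yields distributivity for \<open>cringI\<close> and
    the passage of scalars out of products for \<open>algebraI\<close>.\<close>
  note lin = linear_mapsD[OF bilinear_maps_left[OF mult]]
  have "abelian_group ?A"
  proof (rule abelian_groupI)
    fix x assume "x \<in> carrier ?A"
    then show "\<exists>y \<in> carrier ?A. y \<oplus>\<^bsub>?A\<^esub> x = \<zero>\<^bsub>?A\<^esub>"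
      by (intro bexI[of _ "\<ominus>\<^bsub>S\<^esub> x"]) (simp_all add: M.l_neg)
  qed (simp_all add: M.add.m_ac)
  moreover have "comm_monoid ?A"
  proof (rule comm_monoidI)
    show "x \<otimes>\<^bsub>?A\<^esub> y = y \<otimes>\<^bsub>?A\<^esub> x" if "x \<in> carrier ?A" "y \<in> carrier ?A" for x y
      using that by (simp add: mult_commute)
  qed (simp_all add: bilinear_maps_closed[OF mult] e_closed mult_e_left mult_assoc)
  ultimately have "cring ?A"
    by (rule cringI) (simp add: lin)
  then show ?thesis
    by (rule algebraI[OF R.cring_axioms])
      (simp_all add: lin smult_l_distr smult_r_distr smult_assoc1)
qed

end

lemma multiplication_unique:
  assumes "\<mu> \<in> binary_multiplications R S" "\<mu> (e, e) = e"
    and "\<nu> \<in> binary_multiplications R S" "\<nu> (e, e) = e"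
  shows "\<mu> = \<nu>"
proof (rule extensionalityI[OF bilinear_maps_extensional[OF assms(1)]
      bilinear_maps_extensional[OF assms(3)]])
  fix p assume "p \<in> carrier S \<times> carrier S"
  then obtain x y where p: "p = (x, y)" "x \<in> carrier S" "y \<in> carrier S"
    by blast
  show "\<mu> p = \<nu> p"
    unfolding p(1)
    \<comment> \<open>Now \<open>f\<close> is left multiplication by \<open>x\<close> under
      \<open>\<nu>\<close>, which sends \<open>e\<close> to \<open>x\<close> since \<open>e\<close>
      is a right unit for \<open>\<nu>\<close> too.\<close>
    by (rule mult_eq_linear_map[OF assms(1,2) bilinear_maps_right[OF assms(3)]])
      (simp_all add: p mult_e_right[OF assms(3,4)])
qed

end

theorem proposition1p1:
  fixes R :: "('a, 'm) ring_scheme" and S :: "('a, 'b, 'n) module_scheme" and e :: 'b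
  assumes "cring R" and "module R S" and "e \<in> carrier S"
    and "(\<lambda>f. f e) \<in> linear_isos R (Hom_module R S S) S"
  shows "(\<exists>!\<mu>. \<mu> \<in> binary_multiplications R S \<and> \<mu> (e, e) = e) \<and>
    (\<forall>\<mu>. \<mu> \<in> binary_multiplications R S \<and> \<mu> (e, e) = e \<longrightarrow>
      algebra R (S\<lparr>mult := curry \<mu>, one := e\<rparr>))"
proof -
  interpret evaluation_iso R S e
    using assms by (simp add: evaluation_iso_def evaluation_iso_axioms_def)
  show ?thesis
    using ex_multiplication multiplication_unique algebra_mult by blast
qed

end
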